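(* Let $\mathcal{A}$ be a bounded distributive lattice, let $(\mathcal{B}, \to_{\mathcal{B}})$ be a strong algebra, let $f: \mathcal{A} \to \mathcal{B}$ be an order-preserving map and let $g: \mathcal{B} \to \mathcal{A}$ be a map preserving all finite meets. Define $a \to_{\mathcal{A}} b = g(f(a) \to_{\mathcal{B}} f(b))$ for $a, b \in \mathcal{A}$. Then: (i) if $\to_{\mathcal{B}}$ is open, $f$ preserves binary meets and $g(f(a)) \geq a$ for all $a \in \mathcal{A}$, then $\to_{\mathcal{A}}$ is an open implication over $\mathcal{A}$; (ii) if $\to_{\mathcal{B}}$ is closed, $f$ preserves binary joins, and for all $a \in \mathcal{A}$ and $c \in \mathcal{B}$, $c \vee f(a) = 1$ implies $g(c) \vee a = 1$, then $\to_{\mathcal{A}}$ is a closed implication over $\mathcal{A}$.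
   Context: For a bounded distributive lattice $\mathcal{A}$, an implication over $\mathcal{A}$ is a binary operation $\to$ on $\mathcal{A}$ which is order-reversing in its first argument and order-preserving in its second argument and satisfies $a \to a = 1$ and $(a \to b) \wedge (b \to c) \leq a \to c$ for all $a,b,c$. A strong algebra is a pair $(\mathcal{A},\to)$ of a bounded distributive lattice and an implication over it. An implication is open if for all $a,b,c$, $a \wedge b \leq c$ implies $a \leq b \to c$; it is closed if for all $a,b,c$, $a \leq b \vee c$ implies $(a \to b) \vee c = 1$. *)

theory Defs
  imports Main
begin

text \<open>
  Bounded distributive lattices are types of sort
  \<open>{distrib_lattice, bounded_lattice}\<close>. The lattice of a strong algebra is thus given
  by the type, and \<open>(A, imp)\<close> is a strong algebra iff \<open>implication imp\<close> holds on \<open>A\<close>.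
\<close>

definition implication ::
  "('a::{distrib_lattice, bounded_lattice} \<Rightarrow> 'a \<Rightarrow> 'a) \<Rightarrow> bool" where
  "implication imp \<longleftrightarrow>
     (\<forall>b. antimono (\<lambda>a. imp a b)) \<and>
     (\<forall>a. mono (\<lambda>b. imp a b)) \<and>
     (\<forall>a. imp a a = top) \<and>
     (\<forall>a b c. inf (imp a b) (imp b c) \<le> imp a c)"

definition open_implication ::
  "('a::{distrib_lattice, bounded_lattice} \<Rightarrow> 'a \<Rightarrow> 'a) \<Rightarrow> bool" where
  "open_implication imp \<longleftrightarrow>
     implication imp \<and> (\<forall>a b c. inf a b \<le> c \<longrightarrow> a \<le> imp b c)"

definition closed_implication ::
  "('a::{distrib_lattice, bounded_lattice} \<Rightarrow> 'a \<Rightarrow> 'a) \<Rightarrow> bool" where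
  "closed_implication imp \<longleftrightarrow>
     implication imp \<and> (\<forall>a b c. a \<le> sup b c \<longrightarrow> sup (imp a b) c = top)"

definition preserves_binary_meets :: "('a::lattice \<Rightarrow> 'b::lattice) \<Rightarrow> bool" where
  "preserves_binary_meets f \<longleftrightarrow> (\<forall>a b. f (inf a b) = inf (f a) (f b))"

definition preserves_binary_joins :: "('a::lattice \<Rightarrow> 'b::lattice) \<Rightarrow> bool" where
  "preserves_binary_joins f \<longleftrightarrow> (\<forall>a b. f (sup a b) = sup (f a) (f b))"

text \<open>
  The meet of a finite set, where the empty meet is \<open>top\<close>; the library's \<open>Inf_fin\<close>
  is only meaningful for nonempty sets.
\<close>

definition finite_meet :: "'a::bounded_lattice set \<Rightarrow> 'a" where
  "finite_meet S = Finite_Set.fold inf top S"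

definition preserves_finite_meets ::
  "('a::bounded_lattice \<Rightarrow> 'b::bounded_lattice) \<Rightarrow> bool" where
  "preserves_finite_meets g \<longleftrightarrow>
     (\<forall>S. finite S \<longrightarrow> g (finite_meet S) = finite_meet (g ` S))"

lemma finite_meet_empty [simp]: "finite_meet {} = top"
  by (simp add: finite_meet_def)

lemma finite_meet_insert [simp]:
  "finite S \<Longrightarrow> finite_meet (insert a S) = inf a (finite_meet S)"
proof -
  assume "finite S"
  interpret comp_fun_idem "inf :: 'a \<Rightarrow> 'a \<Rightarrow> 'a" by (rule comp_fun_idem_inf)
  show ?thesis using \<open>finite S\<close> by (simp add: finite_meet_def)
qed

lemma preserves_finite_meets_iff:
  "preserves_finite_meets g \<longleftrightarrow> g top = top \<and> preserves_binary_meets g"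
proof
  assume g: "preserves_finite_meets g"
  have "g top = top"
    using g[unfolded preserves_finite_meets_def, rule_format, of "{}"] by simp
  moreover have "g (inf a b) = inf (g a) (g b)" for a b
    using g[unfolded preserves_finite_meets_def, rule_format, of "{a, b}"] by simp
  ultimately show "g top = top \<and> preserves_binary_meets g"
    by (simp add: preserves_binary_meets_def)
next
  assume g: "g top = top \<and> preserves_binary_meets g"
  have "g (finite_meet S) = finite_meet (g ` S)" if "finite S" for S
    using that by induction (use g in \<open>auto simp: preserves_binary_meets_def\<close>)
  then show "preserves_finite_meets g"
    by (simp add: preserves_finite_meets_def)
qed

end

theory Submission
  imports Defs
begin

text \<open>The implication axioms pass from B to A because \<open>f\<close> is monotone and
  \<open>g\<close> preserves finite meets; this is \<open>implication_pullback\<close>. Openness and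
  closedness are then transported in the same way: push the hypothesis forward along
  \<open>f\<close>, use the property of \<open>impB\<close>, and return along \<open>g\<close>.
  Preservation of meets (or joins) by \<open>f\<close> serves the way out. The way back needs a link
  between \<open>g\<close> and \<open>f\<close>: a \<le> g (f a) in the open case, and the transfer
  of covers of top in the closed case.\<close>

lemma mono_if_preserves_binary_meets:
  assumes "preserves_binary_meets g"
  shows "mono g"
  using assms by (metis inf.absorb_iff1 monoI preserves_binary_meets_def)

text \<open>Each axiom uses one feature of \<open>g\<close>: the empty meet gives reflexivity,
  binary meets together with monotonicity give transitivity, and monotonicity, combined with that of
  \<open>f\<close>, gives both variance conditions.\<close>

lemma implication_pullback:
  assumes imp: "implication imp" and f: "mono f" and g: "preserves_finite_meets g"
  shows "implication (\<lambda>a b. g (imp (f a) (f b)))"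
proof -
  have top: "g top = top" and meet: "g (inf x y) = inf (g x) (g y)" for x y
    using g by (auto simp: preserves_finite_meets_iff preserves_binary_meets_def)
  have mono: "mono g"
    using g by (simp add: preserves_finite_meets_iff mono_if_preserves_binary_meets)
  have anti: "imp y z \<le> imp x z" if "x \<le> y" for x y z
    using imp that by (auto simp: implication_def dest: antimonoD)
  have incr: "imp z x \<le> imp z y" if "x \<le> y" for x y z
    using imp that by (auto simp: implication_def dest: monoD)
  have refl: "imp x x = top" and trans: "inf (imp x y) (imp y z) \<le> imp x z" for x y z
    using imp by (auto simp: implication_def)
  show ?thesis
    unfolding implication_def
  proof (intro conjI allI)
    show "antimono (\<lambda>a. g (imp (f a) (f b)))" for b
      by (intro antimonoI monoD[OF mono] anti monoD[OF f])
    show "mono (\<lambda>b. g (imp (f a) (f b)))" for a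
      by (intro monoI monoD[OF mono] incr monoD[OF f])
    show "g (imp (f a) (f a)) = top" for a
      by (simp add: refl top)
    show "inf (g (imp (f a) (f b))) (g (imp (f b) (f c))) \<le> g (imp (f a) (f c))" for a b c
      using monoD[OF mono trans] by (simp add: meet)
  qed
qed

theorem theorem3p10:
  fixes impB :: "'b::{distrib_lattice, bounded_lattice} \<Rightarrow> 'b \<Rightarrow> 'b"
    and f :: "'a::{distrib_lattice, bounded_lattice} \<Rightarrow> 'b"
    and g :: "'b \<Rightarrow> 'a"
    and impA :: "'a \<Rightarrow> 'a \<Rightarrow> 'a"
  assumes "implication impB"
    and "mono f"
    and "preserves_finite_meets g"
    and "\<And>a b. impA a b = g (impB (f a) (f b))"
  shows "(open_implication impB \<and> preserves_binary_meets f \<and> (\<forall>a. a \<le> g (f a))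
            \<longrightarrow> open_implication impA) \<and>
         (closed_implication impB \<and> preserves_binary_joins f \<and>
          (\<forall>a c. sup c (f a) = top \<longrightarrow> sup (g c) a = top)
            \<longrightarrow> closed_implication impA)"
proof (intro conjI impI; elim conjE)
  have impA: "impA = (\<lambda>a b. g (impB (f a) (f b)))"
    using assms(4) by (intro ext)
  have "implication impA"
    unfolding impA using assms(1-3) by (rule implication_pullback)
  have mono: "mono g"
    using assms(3) by (simp add: preserves_finite_meets_iff mono_if_preserves_binary_meets)
  {
    assume "open_implication impB" and f: "preserves_binary_meets f"
      and unit: "\<forall>a. a \<le> g (f a)"
    then have op: "x \<le> impB y z" if "inf x y \<le> z" for x y z
      using that by (simp add: open_implication_def)
    have "a \<le> impA b c" if "inf a b \<le> c" for a b c
    proof -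
      have "inf (f a) (f b) \<le> f c"
        using monoD[OF assms(2) that] f by (simp add: preserves_binary_meets_def)
      \<comment> \<open>Openness of \<open>impB\<close> turns the last inequality into f a \<le>
        impB (f b) (f c), to which \<open>g\<close> is applied.\<close>
      then have "g (f a) \<le> impA b c"
        unfolding impA by (intro monoD[OF mono] op)
      with unit show ?thesis
        by (blast intro: order_trans)
    qed
    with \<open>implication impA\<close> show "open_implication impA"
      by (simp add: open_implication_def)
  next
    assume "closed_implication impB" and f: "preserves_binary_joins f"
      and cover: "\<forall>a c. sup c (f a) = top \<longrightarrow> sup (g c) a = top"
    then have cl: "sup (impB x y) z = top" if "x \<le> sup y z" for x y z
      using that by (simp add: closed_implication_def)
    have "sup (impA a b) c = top" if "a \<le> sup b c" for a b c
    proof -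
      have "f a \<le> sup (f b) (f c)"
        using monoD[OF assms(2) that] f by (simp add: preserves_binary_joins_def)
      \<comment> \<open>Closedness of \<open>impB\<close> gives sup (impB (f a) (f b)) (f c) = top;
        \<open>cover\<close>, taken at the elements impB (f a) (f b) of B and \<open>c\<close> of A,
        replaces f c by \<open>c\<close>.\<close>
      then show ?thesis
        using cl cover by (simp add: impA)
    qed
    with \<open>implication impA\<close> show "closed_implication impA"
      by (simp add: closed_implication_def)
  }
qed

end
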